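(* Assume that the linear operators $\overline{R}:V\to\overline{V}$ and $\overline{P}:\overline{V}\to V$ satisfy $$\overline{R}\sum_{j\in\mathcal{J}}\widetilde{P}_jG_j(\mathbf{u})=\overline{R}\sum_{j\in\mathcal{J}}\widetilde{P}_jG_j(\overline{P}\,\overline{R}\mathbf{u})\qquad\text{for all }\mathbf{u}\in V.$$ Consider an initial guess $\mathbf{u}^0\in V$ and its substructured restriction $\mathbf{v}^0:=\overline{R}\mathbf{u}^0\in\overline{V}$, and define the sequences $\{\mathbf{u}^n\}$, $\{\mathbf{v}^n\}$ by $$\mathbf{u}^n=\sum_{j\in\mathcal{J}}\widetilde{P}_jG_j(\mathbf{u}^{n-1}),\qquad \mathbf{v}^n=\sum_{j\in\mathcal{J}}\overline{G}_j(\mathbf{v}^{n-1}),\qquad n\ge1.$$ Then $\overline{R}\mathbf{u}^n=\mathbf{v}^n$ for every $n\ge 1$.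
   Context: Let $V\cong\mathbb{R}^{N_v}$ and let $F:V\to V$ be a (nonlinear) function; the problem to be solved is $F(\mathbf{u})=0$. Let $\mathcal{J}=\{1,\dots,N\}$, and for each $j\in\mathcal{J}$ let $V_j$ be a finite-dimensional real vector space with linear maps $R_j:V\to V_j$, $P_j:V_j\to V$, $\widetilde{P}_j:V_j\to V$ satisfying $R_jP_j=I_{V_j}$ for every $j$ and $\sum_{j\in\mathcal{J}}\widetilde{P}_jR_j=I$ (identities on $V_j$ and $V$). The local solution operators $G_j:V\to V_j$ are defined through $$R_jF\bigl(P_jG_j(\mathbf{u})+(I-P_jR_j)\mathbf{u}\bigr)=0,\qquad \mathbf{u}\in V,$$ and are assumed to be well defined by this relation. Let $\overline{V}\cong\mathbb{R}^{\overline{N}}$ (degrees of freedom on the substructure), with linear maps $\overline{R}:V\to\overline{V}$ and $\overline{P}:\overline{V}\to V$ satisfying $\overline{R}\,\overline{P}=\overline{I}$, the identity on $\overline{V}$. The substructured local operators $\overline{G}_j:\overline{V}\to\overline{V}$ are $$\overline{G}_j(\mathbf{v}):=\overline{R}\,\widetilde{P}_jG_j(\overline{P}\mathbf{v}).$$ *)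

theory Defs
  imports "HOL-Analysis.Analysis"
begin

text \<open>
  The spaces $V_j$ may have different dimensions, so they cannot be types indexed by $j$.
  They are represented as finite-dimensional subspaces \<open>W j\<close> of one real vector space of
  arbitrary (possibly infinite) dimension; every family of vector spaces arises in this way
  up to isomorphism, inside its direct sum.  The spaces $V$ and $\overline{V}$ are types;
  dimension zero is not excluded.
\<close>

definition finite_dim_subspace :: "'a::real_vector set \<Rightarrow> bool" where
  "finite_dim_subspace S \<longleftrightarrow> subspace S \<and> (\<exists>B. finite B \<and> span B = S)"

text \<open>
  For a subspace \<open>S\<close>; nothing is required of the values outside \<open>S\<close>.
\<close>

definition linear_on :: "'a::real_vector set \<Rightarrow> ('a \<Rightarrow> 'b::real_vector) \<Rightarrow> bool" where
  "linear_on S f \<longleftrightarrow>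
     (\<forall>x\<in>S. \<forall>y\<in>S. f (x + y) = f x + f y) \<and> (\<forall>c. \<forall>x\<in>S. f (c *\<^sub>R x) = c *\<^sub>R f x)"

definition solves_local ::
    "('v::real_vector \<Rightarrow> 'v) \<Rightarrow> 'w::real_vector set \<Rightarrow> ('v \<Rightarrow> 'w) \<Rightarrow> ('w \<Rightarrow> 'v) \<Rightarrow> 'v \<Rightarrow> 'w \<Rightarrow> bool" where
  "solves_local F Wj Rj Pj u w \<longleftrightarrow> w \<in> Wj \<and> Rj (F (Pj w + (u - Pj (Rj u)))) = 0"

definition substructured_op ::
    "('v \<Rightarrow> 's) \<Rightarrow> ('s \<Rightarrow> 'v) \<Rightarrow> ('w \<Rightarrow> 'v) \<Rightarrow> ('v \<Rightarrow> 'w) \<Rightarrow> 's \<Rightarrow> 's" where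
  "substructured_op Rbar Pbar Ptj Gj v = Rbar (Ptj (Gj (Pbar v)))"

end

theory Submission
  imports Defs
begin

text \<open>Write T for the map sending \<open>x\<close> to the sum of \<open>Pt j (G j x)\<close>,
  and S for the sum of the substructured operators. Linearity of \<open>Rbar\<close> gives S(y) =
  Rbar(T(Pbar y)), and the compatibility hypothesis says that the restriction of T(x) depends on
  \<open>x\<close> only through \<open>Rbar x\<close>. Together they give Rbar(T(x)) = S(Rbar x):
  the restriction intertwines the two fixed-point maps, so it carries the orbit of
  \<open>u 0\<close> under T to the orbit of \<open>Rbar (u 0)\<close> under S.\<close>

theorem theorem4p1:
  fixes F :: "'v::real_vector \<Rightarrow> 'v"
    and N :: nat
    and W :: "nat \<Rightarrow> 'w::real_vector set"
    and R :: "nat \<Rightarrow> 'v \<Rightarrow> 'w"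
    and P Pt :: "nat \<Rightarrow> 'w \<Rightarrow> 'v"
    and G :: "nat \<Rightarrow> 'v \<Rightarrow> 'w"
    and Rbar :: "'v \<Rightarrow> 's::real_vector"
    and Pbar :: "'s \<Rightarrow> 'v"
    and u :: "nat \<Rightarrow> 'v"
    and v :: "nat \<Rightarrow> 's"
  assumes V_findim: "finite_dim_subspace (UNIV :: 'v set)"
    and Vbar_findim: "finite_dim_subspace (UNIV :: 's set)"
    and W_findim: "\<And>j. j \<in> {1..N} \<Longrightarrow> finite_dim_subspace (W j)"
    and R_linear: "\<And>j. j \<in> {1..N} \<Longrightarrow> linear (R j)"
    and R_range: "\<And>j x. j \<in> {1..N} \<Longrightarrow> R j x \<in> W j"
    and P_linear: "\<And>j. j \<in> {1..N} \<Longrightarrow> linear_on (W j) (P j)"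
    and Pt_linear: "\<And>j. j \<in> {1..N} \<Longrightarrow> linear_on (W j) (Pt j)"
    and R_P: "\<And>j w. j \<in> {1..N} \<Longrightarrow> w \<in> W j \<Longrightarrow> R j (P j w) = w"
    and partition_of_unity: "\<And>x. (\<Sum>j\<in>{1..N}. Pt j (R j x)) = x"
    and G_well_defined: "\<And>j x. j \<in> {1..N} \<Longrightarrow> \<exists>!w. solves_local F (W j) (R j) (P j) x w"
    and G_solves: "\<And>j x. j \<in> {1..N} \<Longrightarrow> solves_local F (W j) (R j) (P j) x (G j x)"
    and Rbar_linear: "linear Rbar"
    and Pbar_linear: "linear Pbar"
    and Rbar_Pbar: "\<And>y. Rbar (Pbar y) = y"
    and substructure_compat:
      "\<And>x. Rbar (\<Sum>j\<in>{1..N}. Pt j (G j x)) = Rbar (\<Sum>j\<in>{1..N}. Pt j (G j (Pbar (Rbar x))))"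
    and v_init: "v 0 = Rbar (u 0)"
    and u_step: "\<And>n. n \<ge> 1 \<Longrightarrow> u n = (\<Sum>j\<in>{1..N}. Pt j (G j (u (n - 1))))"
    and v_step: "\<And>n. n \<ge> 1 \<Longrightarrow>
      v n = (\<Sum>j\<in>{1..N}. substructured_op Rbar Pbar (Pt j) (G j) (v (n - 1)))"
  shows "\<forall>n\<ge>1. Rbar (u n) = v n"
proof -
  \<comment> \<open>The induction starts at 0 rather than 1, so that the base case is just the
    choice of the initial guess \<open>v 0\<close>.\<close>
  have "Rbar (u n) = v n" for n
  proof (induction n)
    case 0
    show ?case by (simp add: v_init)
  next
    case (Suc n)
    \<comment> \<open>Compatibility is applied at \<open>u n\<close>: the full iterate now enters
      only through its restriction, which is what the induction hypothesis controls.\<close>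
    have "Rbar (u (Suc n)) = Rbar (\<Sum>j\<in>{1..N}. Pt j (G j (Pbar (Rbar (u n)))))"
      using u_step[of "Suc n"] substructure_compat[of "u n"] by simp
    \<comment> \<open>Linearity of \<open>Rbar\<close> turns the restriction of the global sum into
      a sum of local restrictions, each of which is a substructured operator at
      \<open>v n\<close>.\<close>
    also have "\<dots> = (\<Sum>j\<in>{1..N}. substructured_op Rbar Pbar (Pt j) (G j) (v n))"
      by (simp only: Suc.IH linear_sum[OF Rbar_linear] substructured_op_def)
    also have "\<dots> = v (Suc n)"
      using v_step[of "Suc n"] by simp
    finally show ?case .
  qed
  then show ?thesis by blast
qed

end
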